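(* Let $\phi=\phi_{k-1}\circ\dots\circ\phi_0$ be a Hamiltonian diffeomorphism of $\mathbb{R}^{2d}$ factorized into Hamiltonian diffeomorphisms $\phi_j$ with generating functions $f_j:\mathbb{R}^{2d}\to\mathbb{R}$, and let $F:\mathbb{R}^{2dk}\to\mathbb{R}$ be the associated generating family. For all critical points $\boldsymbol z$ of $F$, we have $$\min\{\mathrm{ind}(\boldsymbol z),\mathrm{coind}(\boldsymbol z)\}\ \geq\ d\,\lfloor k/2\rfloor .$$
   Context: Points of $\mathbb{R}^{2d}$ are written $z=(x,y)$ with $x,y\in\mathbb{R}^d$, and $\mathbb{R}^{2d}$ carries the standard symplectic form $dx\wedge dy$. A smooth function $f:\mathbb{R}^{2d}\to\mathbb{R}$ is a generating function for a Hamiltonian diffeomorphism $\psi$ of $\mathbb{R}^{2d}$ if, for all $(x_0,y_0),(x_1,y_1)$, $$\psi(x_0,y_0)=(x_1,y_1)\iff x_1-x_0=-\partial_yf(x_1,y_0)\ \text{ and }\ y_1-y_0=\partial_xf(x_1,y_0).$$ Given $\phi=\phi_{k-1}\circ\dots\circ\phi_0$ with generating functions $f_j$ for $\phi_j$, the generating family $F:\mathbb{R}^{2dk}\to\mathbb{R}$ is $$F(z_0,\dots,z_{k-1})=\sum_{j\in\mathbb{Z}_k}\big(\langle y_j,x_{j+1}-x_j\rangle+f_j(x_{j+1},y_j)\big),\qquad z_j=(x_j,y_j),$$ with indices $j$ cyclic modulo $k$. Its critical points $\boldsymbol z=(z_0,\dots,z_{k-1})$ are those with $\phi_j(z_j)=z_{j+1}$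 for all $j\in\mathbb{Z}_k$. The Morse index $\mathrm{ind}(\boldsymbol z)$ (resp. coindex $\mathrm{coind}(\boldsymbol z)$) is the number of negative (resp. positive) eigenvalues, with multiplicity, of the Hessian of $F$ at $\boldsymbol z$. Standing assumption: $k$ is large enough so that the operator norms of the $d\times d$ matrices $A_j=\partial_{xx}f_j(x_{j+1},y_j)$, $B_j=\partial_{xy}f_j(x_{j+1},y_j)$, $C_j=\partial_{yy}f_j(x_{j+1},y_j)$ at the critical points under consideration are bounded from above by some constant $\epsilon<1$. *)

theory Defs
  imports "HOL-Analysis.Analysis" "Berlekamp_Zassenhaus.Finite_Field"
begin

subsection \<open>Smooth maps, gradients and Hessians\<close>

text \<open>A map is \<open>C\<^sup>n\<^sup>+\<^sup>1\<close> iff it is differentiable everywhere and all its directional derivatives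
  are \<open>C\<^sup>n\<close>; in finite dimension this is the usual notion.\<close>

primrec C_diff :: "nat \<Rightarrow> ('a::euclidean_space \<Rightarrow> 'b::real_normed_vector) \<Rightarrow> bool" where
  "C_diff 0 f \<longleftrightarrow> continuous_on UNIV f"
| "C_diff (Suc n) f \<longleftrightarrow>
     (\<exists>f'. (\<forall>x. (f has_derivative f' x) (at x)) \<and> (\<forall>v. C_diff n (\<lambda>x. f' x v)))"

definition smooth :: "('a::euclidean_space \<Rightarrow> 'b::real_normed_vector) \<Rightarrow> bool" where
  "smooth f \<longleftrightarrow> (\<forall>n. C_diff n f)"

definition diffeomorphism :: "('a::euclidean_space \<Rightarrow> 'a) \<Rightarrow> bool" where
  "diffeomorphism \<psi> \<longleftrightarrow> bij \<psi> \<and> smooth \<psi> \<and> smooth (inv_into UNIV \<psi>)"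

definition gradient :: "('a::euclidean_space \<Rightarrow> real) \<Rightarrow> 'a \<Rightarrow> 'a" where
  "gradient f x = (\<Sum>b\<in>Basis. frechet_derivative f (at x) b *\<^sub>R b)"

text \<open>The Hessian as a linear operator. For a twice differentiable \<open>f\<close>, its matrix in the
  standard basis is the matrix of second partial derivatives.\<close>

definition hessian :: "('a::euclidean_space \<Rightarrow> real) \<Rightarrow> 'a \<Rightarrow> 'a \<Rightarrow> 'a" where
  "hessian f x = frechet_derivative (gradient f) (at x)"

definition critical_point :: "('a::euclidean_space \<Rightarrow> real) \<Rightarrow> 'a \<Rightarrow> bool" where
  "critical_point f x \<longleftrightarrow> (f has_derivative (\<lambda>v. 0)) (at x)"

definition eigenspace :: "('a::real_vector \<Rightarrow> 'a) \<Rightarrow> real \<Rightarrow> 'a set" where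
  "eigenspace T c = {v. T v = c *\<^sub>R v}"

definition eigenvalues :: "('a::real_vector \<Rightarrow> 'a) \<Rightarrow> real set" where
  "eigenvalues T = {c. \<exists>v. v \<noteq> 0 \<and> T v = c *\<^sub>R v}"

text \<open>The multiplicity of an eigenvalue is the dimension of its eigenspace, which for a symmetric
  operator is also its algebraic multiplicity. The sums are finite, since a linear operator on a
  finite-dimensional space has finitely many eigenvalues.\<close>

definition morse_index :: "('a::euclidean_space \<Rightarrow> real) \<Rightarrow> 'a \<Rightarrow> nat" where
  "morse_index f x = (\<Sum>c\<in>{c \<in> eigenvalues (hessian f x). c < 0}. dim (eigenspace (hessian f x) c))"

definition morse_coindex :: "('a::euclidean_space \<Rightarrow> real) \<Rightarrow> 'a \<Rightarrow> nat" where
  "morse_coindex f x = (\<Sum>c\<in>{c \<in> eigenvalues (hessian f x). c > 0}. dim (eigenspace (hessian f x) c))"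

subsection \<open>Hamiltonian diffeomorphisms and generating functions\<close>

text \<open>Points of the phase space are pairs \<open>(x, y)\<close>.\<close>

type_synonym 'd phase = "(real ^ 'd) \<times> (real ^ 'd)"

text \<open>The form \<open>dx \<and> dy\<close>.\<close>

definition symplectic_form :: "'d::finite phase \<Rightarrow> 'd phase \<Rightarrow> real" where
  "symplectic_form u v = fst u \<bullet> snd v - snd u \<bullet> fst v"

text \<open>Time-one maps of isotopies generated by time-dependent Hamiltonian vector fields \<open>X\<close>, where
  \<open>\<omega>(X\<^sub>t, \<cdot>) = dH\<^sub>t\<close>; the opposite sign convention gives the same class of maps, by replacing \<open>H\<close> with
  \<open>-H\<close>. Only the values of \<open>H\<close> at times in \<open>[0,1]\<close> matter. No bound or support condition
  is imposed on \<open>H\<close>, only that the flow be defined on \<open>[0,1]\<close> and consist of diffeomorphisms; the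
  smoothness of the flow jointly in time and space is then automatic.\<close>

definition hamiltonian_diffeo :: "('d::finite phase \<Rightarrow> 'd phase) \<Rightarrow> bool" where
  "hamiltonian_diffeo \<psi> \<longleftrightarrow>
    (\<exists>(H :: real \<Rightarrow> 'd phase \<Rightarrow> real) (\<Phi> :: real \<Rightarrow> 'd phase \<Rightarrow> 'd phase).
       smooth (\<lambda>(t, z). H t z) \<and> \<Phi> 0 = id \<and> \<Phi> 1 = \<psi> \<and>
       (\<forall>t\<in>{0..1}. diffeomorphism (\<Phi> t)) \<and>
       (\<forall>t\<in>{0..1}. \<forall>z. \<exists>X. ((\<lambda>s. \<Phi> s z) has_vector_derivative X) (at t within {0..1}) \<and>
          (\<forall>v. symplectic_form X v = frechet_derivative (H t) (at (\<Phi> t z)) v)))"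

definition grad_x :: "('d::finite phase \<Rightarrow> real) \<Rightarrow> real ^ 'd \<Rightarrow> real ^ 'd \<Rightarrow> real ^ 'd" where
  "grad_x f x y = gradient (\<lambda>x'. f (x', y)) x"

definition grad_y :: "('d::finite phase \<Rightarrow> real) \<Rightarrow> real ^ 'd \<Rightarrow> real ^ 'd \<Rightarrow> real ^ 'd" where
  "grad_y f x y = gradient (\<lambda>y'. f (x, y')) y"

definition hess_xx :: "('d::finite phase \<Rightarrow> real) \<Rightarrow> real ^ 'd \<Rightarrow> real ^ 'd \<Rightarrow> real ^ 'd \<Rightarrow> real ^ 'd" where
  "hess_xx f x y = frechet_derivative (\<lambda>x'. grad_x f x' y) (at x)"

definition hess_xy :: "('d::finite phase \<Rightarrow> real) \<Rightarrow> real ^ 'd \<Rightarrow> real ^ 'd \<Rightarrow> real ^ 'd \<Rightarrow> real ^ 'd" where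
  "hess_xy f x y = frechet_derivative (\<lambda>y'. grad_x f x y') (at y)"

definition hess_yy :: "('d::finite phase \<Rightarrow> real) \<Rightarrow> real ^ 'd \<Rightarrow> real ^ 'd \<Rightarrow> real ^ 'd \<Rightarrow> real ^ 'd" where
  "hess_yy f x y = frechet_derivative (\<lambda>y'. grad_y f x y') (at y)"

definition generating_function :: "('d::finite phase \<Rightarrow> real) \<Rightarrow> ('d phase \<Rightarrow> 'd phase) \<Rightarrow> bool" where
  "generating_function f \<psi> \<longleftrightarrow> smooth f \<and>
    (\<forall>x0 y0 x1 y1. \<psi> (x0, y0) = (x1, y1) \<longleftrightarrow>
       x1 - x0 = - grad_y f x1 y0 \<and> y1 - y0 = grad_x f x1 y0)"

subsection \<open>Generating families\<close>

text \<open>The cyclic indices \<open>\<int>\<^sub>k\<close> are modelled by \<open>'k mod_ring\<close> with \<open>k = CARD('k) \<ge> 1\<close>. The class of a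
  natural number is taken via \<^const>\<open>of_int_mod_ring\<close>, as the unit \<open>1 :: 'k mod_ring\<close> and
  \<^const>\<open>of_nat\<close> are only available for \<open>k \<ge> 2\<close>.\<close>

definition zmod :: "nat \<Rightarrow> 'k::finite mod_ring" where
  "zmod n = of_int_mod_ring (int n)"

definition next_index :: "'k::finite mod_ring \<Rightarrow> 'k mod_ring" where
  "next_index j = j + zmod 1"

text \<open>\<open>\<phi>\<^sub>k\<^sub>-\<^sub>1 \<circ> \<dots> \<circ> \<phi>\<^sub>0\<close>\<close>

definition cyclic_comp :: "('k::finite mod_ring \<Rightarrow> 'a \<Rightarrow> 'a) \<Rightarrow> 'a \<Rightarrow> 'a" where
  "cyclic_comp \<phi> = fold (\<lambda>n g. \<phi> (zmod n) \<circ> g) [0..<CARD('k)] id"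

definition generating_family ::
    "('k::finite mod_ring \<Rightarrow> 'd::finite phase \<Rightarrow> real) \<Rightarrow> 'd phase ^ ('k mod_ring) \<Rightarrow> real" where
  "generating_family f z =
    (\<Sum>j\<in>UNIV. snd (z $ j) \<bullet> (fst (z $ next_index j) - fst (z $ j))
       + f j (fst (z $ next_index j), snd (z $ j)))"

end

theory Submission
  imports Defs
begin

text \<open>
  The second derivative of the generating family at \<open>z\<close> in direction \<open>w = (\<xi>\<^sub>j, \<eta>\<^sub>j)\<^sub>j\<close> is
  \<open>\<Sum>\<^sub>j 2\<langle>\<eta>\<^sub>j, \<xi>\<^sub>j\<^sub>+\<^sub>1 - \<xi>\<^sub>j\<rangle> + \<langle>A\<^sub>j \<xi>\<^sub>j\<^sub>+\<^sub>1, \<xi>\<^sub>j\<^sub>+\<^sub>1\<rangle> + 2\<langle>B\<^sub>j \<eta>\<^sub>j, \<xi>\<^sub>j\<^sub>+\<^sub>1\<rangle> + \<langle>C\<^sub>j \<eta>\<^sub>j, \<eta>\<^sub>j\<rangle>\<close>.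
  If \<open>w\<close> is supported on pairwise non-adjacent indices, all products of \<open>\<eta>\<^sub>j\<close> with \<open>\<xi>\<^sub>j\<^sub>+\<^sub>1\<close> vanish. Taking
  \<open>\<eta>\<^sub>j = \<plusminus>\<xi>\<^sub>j\<close> on such a support leaves \<open>\<Sum>\<^sub>j \<mp>2|\<xi>\<^sub>j|\<^sup>2\<close> plus an error of size at most
  \<open>2\<epsilon> \<Sum>\<^sub>j |\<xi>\<^sub>j|\<^sup>2\<close>, so the Hessian is definite there. Since \<open>\<lfloor>k/2\<rfloor>\<close> non-adjacent indices exist
  in \<open>\<int>\<^sub>k\<close>, this gives a negative and a positive definite subspace of dimension \<open>d\<lfloor>k/2\<rfloor>\<close>.
\<close>

subsection \<open>Definite subspaces and eigenvalues of symmetric operators\<close>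

text \<open>Compactness of the unit sphere of \<open>S\<close> gives a minimizer \<open>v\<close> of
  the quadratic form. The residual \<open>T v - c *\<^sub>R v\<close> lies in \<open>S\<close> by
  invariance, and if nonzero, moving \<open>v\<close> against it would push the form below its
  minimum.\<close>

lemma rayleigh_minimizer:
  fixes T :: "'a::euclidean_space \<Rightarrow> 'a"
  assumes lin: "linear T" and sym: "\<And>u v. T u \<bullet> v = u \<bullet> T v"
    and S: "subspace S" "S \<noteq> {0}" and inv: "\<And>v. v \<in> S \<Longrightarrow> T v \<in> S"
  obtains c v where "v \<in> S" "v \<noteq> 0" "T v = c *\<^sub>R v" "\<And>w. w \<in> S \<Longrightarrow> c * (w \<bullet> w) \<le> T w \<bullet> w"
proof -
  have bl: "bounded_linear T" using lin by (simp add: linear_conv_bounded_linear)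
  have normalized: "(1 / norm x) *\<^sub>R x \<in> S \<inter> sphere 0 1" if "x \<in> S" "x \<noteq> 0" for x
    using that S by (auto simp: subspace_scale)
  obtain x where x: "x \<in> S" "x \<noteq> 0"
    using S subspace_0 by fastforce
  have "S \<inter> sphere 0 1 \<noteq> {}"
    using normalized[OF x] by blast
  moreover have "compact (S \<inter> sphere 0 1)"
    using S(1) by (simp add: closed_Int_compact closed_subspace)
  moreover have "continuous_on (S \<inter> sphere 0 1) (\<lambda>w. T w \<bullet> w)"
    by (intro continuous_intros linear_continuous_on bl)
  ultimately have "\<exists>v\<in>S \<inter> sphere 0 1. \<forall>w\<in>S \<inter> sphere 0 1. T v \<bullet> v \<le> T w \<bullet> w"
    by (intro continuous_attains_inf)
  then obtain v where v: "v \<in> S \<inter> sphere 0 1"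
    and min: "\<And>w. w \<in> S \<inter> sphere 0 1 \<Longrightarrow> T v \<bullet> v \<le> T w \<bullet> w"
    by blast
  define c where "c = T v \<bullet> v"
  have vv: "v \<bullet> v = 1" using v by (simp add: dot_square_norm)
  have le: "c * (w \<bullet> w) \<le> T w \<bullet> w" if "w \<in> S" for w
  proof (cases "w = 0")
    case True then show ?thesis by simp
  next
    case False
    have "c \<le> T ((1 / norm w) *\<^sub>R w) \<bullet> ((1 / norm w) *\<^sub>R w)"
      unfolding c_def by (rule min[OF normalized[OF that False]])
    also have "\<dots> = (T w \<bullet> w) / (w \<bullet> w)"
      by (simp add: linear_scale[OF lin] dot_square_norm power2_eq_square)
    finally show ?thesis using False by (simp add: field_simps)
  qed
  \<comment> \<open>\<open>q\<close> is the form shifted so that it is nonnegative on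
    \<open>S\<close> with a zero at \<open>v\<close>; \<open>w\<close> is the residual to be shown
    zero.\<close>
  define q where "q w = T w \<bullet> w - c * (w \<bullet> w)" for w
  define w where "w = T v - c *\<^sub>R v"
  have wS: "w \<in> S" using v inv S(1) by (simp add: w_def subspace_diff subspace_scale)
  have q_line: "q (v - a *\<^sub>R w) = a * (a * q w - 2 * (w \<bullet> w))" for a
  proof -
    have "q (v - a *\<^sub>R w) = q v - 2 * a * (T v \<bullet> w - c * (v \<bullet> w)) + a\<^sup>2 * q w"
      using sym[of w v]
      by (simp add: q_def linear_diff[OF lin] linear_scale[OF lin] inner_diff_left inner_diff_right
          inner_commute power2_eq_square algebra_simps)
    moreover have "T v \<bullet> w - c * (v \<bullet> w) = w \<bullet> w"
      by (simp add: w_def inner_diff_left inner_diff_right inner_commute algebra_simps)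
    moreover have "q v = 0" using vv by (simp add: q_def c_def)
    ultimately show ?thesis by (simp add: power2_eq_square algebra_simps)
  qed
  have "w = 0"
  proof (rule ccontr)
    assume "w \<noteq> 0"
    then have n: "w \<bullet> w > 0" by simp
    have qw: "q w \<ge> 0" using le[OF wS] by (simp add: q_def)
    \<comment> \<open>Small enough that \<open>2 * (w \<bullet> w)\<close> dominates
      \<open>a * q w\<close>; the \<open>+ 1\<close> covers \<open>q w = 0\<close>.\<close>
    define a where "a = (w \<bullet> w) / (q w + 1)"
    have a: "a > 0" using n qw by (simp add: a_def)
    have "a * q w \<le> w \<bullet> w" using n qw by (simp add: a_def field_simps)
    then have "a * q w - 2 * (w \<bullet> w) < 0" using n by linarith
    then have "q (v - a *\<^sub>R w) < 0" unfolding q_line using a by (simp add: mult_pos_neg)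
    moreover have "v - a *\<^sub>R w \<in> S" using v wS S(1) by (simp add: subspace_diff subspace_scale)
    ultimately show False using le[of "v - a *\<^sub>R w"] by (simp add: q_def)
  qed
  then have "T v = c *\<^sub>R v" by (simp add: w_def)
  moreover have "v \<noteq> 0" using vv by auto
  ultimately show ?thesis using that v le by blast
qed

lemma dim_UN_le_sum:
  fixes W :: "'i \<Rightarrow> 'a::euclidean_space set"
  assumes "finite I"
  shows "dim (\<Union>i\<in>I. W i) \<le> (\<Sum>i\<in>I. dim (W i))"
proof -
  have "\<exists>B. finite B \<and> W i \<subseteq> span B \<and> card B = dim (W i)" for i
    using basis_exists[of "W i"] finiteI_independent by metis
  then obtain B where B: "\<And>i. finite (B i)" "\<And>i. W i \<subseteq> span (B i)" "\<And>i. card (B i) = dim (W i)"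
    by metis
  have "(\<Union>i\<in>I. W i) \<subseteq> span (\<Union>i\<in>I. B i)"
    using B(2) span_mono[of "B _" "\<Union>i\<in>I. B i"] by blast
  then have "dim (\<Union>i\<in>I. W i) \<le> card (\<Union>i\<in>I. B i)"
    using assms B(1) by (intro dim_le_card) auto
  also have "\<dots> \<le> (\<Sum>i\<in>I. dim (W i))"
    using card_UN_le[OF assms, of B] B(3) by simp
  finally show ?thesis .
qed

lemma eigenvectors_orthogonal:
  fixes T :: "'a::real_inner \<Rightarrow> 'a"
  assumes sym: "\<And>u v. T u \<bullet> v = u \<bullet> T v"
    and "T u = a *\<^sub>R u" "T v = b *\<^sub>R v" "a \<noteq> b"
  shows "u \<bullet> v = 0"
  using sym[of u v] assms(2-4) by simp

text \<open>Eigenvectors chosen one per eigenvalue are nonzero and pairwise orthogonal, so finite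
  dimension leaves only finitely many.\<close>

lemma finite_eigenvalues:
  fixes T :: "'a::euclidean_space \<Rightarrow> 'a"
  assumes sym: "\<And>u v. T u \<bullet> v = u \<bullet> T v"
  shows "finite (eigenvalues T)"
proof -
  obtain e where e: "\<And>c. c \<in> eigenvalues T \<Longrightarrow> e c \<noteq> 0 \<and> T (e c) = c *\<^sub>R e c"
    using bchoice[of "eigenvalues T" "\<lambda>c v. v \<noteq> 0 \<and> T v = c *\<^sub>R v"]
    by (auto simp: eigenvalues_def)
  have orth: "e a \<bullet> e b = 0" if "a \<in> eigenvalues T" "b \<in> eigenvalues T" "a \<noteq> b" for a b
    using eigenvectors_orthogonal[OF sym] e that by blast
  have "pairwise orthogonal (e ` eigenvalues T)"
    unfolding pairwise_def orthogonal_def using orth by blast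
  then have "finite (e ` eigenvalues T)" by (rule pairwise_orthogonal_imp_finite)
  moreover have "inj_on e (eigenvalues T)"
  proof (rule inj_onI, rule ccontr)
    fix a b assume "a \<in> eigenvalues T" "b \<in> eigenvalues T" "e a = e b" "a \<noteq> b"
    then show False using orth[of a b] e[of b] by simp
  qed
  ultimately show ?thesis using finite_imageD by blast
qed

text \<open>On the orthogonal complement of the span of the negative eigenspaces, the Rayleigh quotient of
  \<open>T\<close> is nonnegative, as its minimum is an eigenvalue; hence \<open>V\<close> meets this complement trivially.\<close>

lemma dim_negative_subspace_le:
  fixes T :: "'a::euclidean_space \<Rightarrow> 'a"
  assumes lin: "linear T" and sym: "\<And>u v. T u \<bullet> v = u \<bullet> T v"
    and V: "subspace V" and neg: "\<And>v. v \<in> V \<Longrightarrow> v \<noteq> 0 \<Longrightarrow> T v \<bullet> v < 0"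
  shows "dim V \<le> (\<Sum>c | c \<in> eigenvalues T \<and> c < 0. dim (eigenspace T c))"
proof -
  define C where "C = {c \<in> eigenvalues T. c < 0}"
  define N where "N = span (\<Union>c\<in>C. eigenspace T c)"
  \<comment> \<open>By symmetry, invariance of \<open>N\<close> passes to its orthogonal complement,
    so \<open>rayleigh_minimizer\<close> applies there.\<close>
  have TN: "T x \<in> N" if "x \<in> N" for x
    using that unfolding N_def
  proof (induction rule: span_induct_alt)
    case base
    then show ?case by (simp add: linear_0[OF lin] span_zero)
  next
    case (step a x y)
    then obtain c where "c \<in> C" "x \<in> eigenspace T c" by blast
    then have "x \<in> N" "T x = c *\<^sub>R x" unfolding N_def by (auto simp: eigenspace_def intro: span_base)
    then show ?case
      using step by (simp add: linear_add[OF lin] linear_scale[OF lin] N_def span_add span_scale)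
  qed
  have pos: "T w \<bullet> w \<ge> 0" if w: "w \<in> orthogonal_comp N" for w
  proof (cases "orthogonal_comp N = {0}")
    case True
    then show ?thesis using w by simp
  next
    case False
    have "T u \<in> orthogonal_comp N" if "u \<in> orthogonal_comp N" for u
      using that TN sym[of u] by (auto simp: orthogonal_comp_def orthogonal_def inner_commute)
    then obtain c v where cv: "v \<in> orthogonal_comp N" "v \<noteq> 0" "T v = c *\<^sub>R v"
      and min: "\<And>w. w \<in> orthogonal_comp N \<Longrightarrow> c * (w \<bullet> w) \<le> T w \<bullet> w"
      using rayleigh_minimizer[OF lin sym subspace_orthogonal_comp False] by metis
    \<comment> \<open>A negative minimum would be an eigenvalue in \<open>C\<close>, putting
      \<open>v\<close> both in \<open>N\<close> and in its complement.\<close>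
    have "c \<ge> 0"
    proof (rule ccontr)
      assume "\<not> c \<ge> 0"
      then have "c \<in> C" using cv by (auto simp: C_def eigenvalues_def)
      then have "v \<in> N" using cv unfolding N_def by (auto simp: eigenspace_def intro!: span_base)
      then have "v \<bullet> v = 0" using cv(1) by (auto simp: orthogonal_comp_def orthogonal_def)
      then show False using cv(2) by simp
    qed
    then show ?thesis using min[OF w] by (meson inner_ge_zero mult_nonneg_nonneg order_trans)
  qed
  have "V \<inter> orthogonal_comp N \<subseteq> {0}" using neg pos by fastforce
  then have "dim (V \<inter> orthogonal_comp N) = 0" by (simp only: dim_eq_0)
  then have "dim V + dim (orthogonal_comp N) = dim {x + y |x y. x \<in> V \<and> y \<in> orthogonal_comp N}"
    using dim_sums_Int[OF V subspace_orthogonal_comp, of N] by linarith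
  also have "\<dots> \<le> DIM('a)" by (rule dim_subset_UNIV)
  also have "DIM('a) = dim N + dim (orthogonal_comp N)"
    using dim_subspace_orthogonal_to_vectors[of N UNIV]
    by (simp add: N_def orthogonal_comp_def orthogonal_commute)
  finally have "dim V \<le> dim N" by simp
  also have "\<dots> \<le> (\<Sum>c\<in>C. dim (eigenspace T c))"
    unfolding N_def dim_span
    using finite_eigenvalues[OF sym] by (intro dim_UN_le_sum) (auto simp: C_def)
  finally show ?thesis unfolding C_def by simp
qed

text \<open>Passing to \<open>- T\<close> turns positive eigenvalues into negative ones with the
  same eigenspaces.\<close>

lemma dim_positive_subspace_le:
  fixes T :: "'a::euclidean_space \<Rightarrow> 'a"
  assumes lin: "linear T" and sym: "\<And>u v. T u \<bullet> v = u \<bullet> T v"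
    and V: "subspace V" and pos: "\<And>v. v \<in> V \<Longrightarrow> v \<noteq> 0 \<Longrightarrow> T v \<bullet> v > 0"
  shows "dim V \<le> (\<Sum>c | c \<in> eigenvalues T \<and> c > 0. dim (eigenspace T c))"
proof -
  have "dim V \<le> (\<Sum>c | c \<in> eigenvalues (\<lambda>v. - T v) \<and> c < 0. dim (eigenspace (\<lambda>v. - T v) c))"
    using pos sym by (intro dim_negative_subspace_le V linear_compose_neg lin) auto
  also have "\<dots> = (\<Sum>c | c \<in> eigenvalues T \<and> c > 0. dim (eigenspace T c))"
  proof (rule sum.reindex_bij_witness[of _ uminus uminus])
    have swap: "- T v = c *\<^sub>R v \<longleftrightarrow> T v = (- c) *\<^sub>R v" for c v
      using neg_equal_iff_equal[of "- T v" "c *\<^sub>R v"] by simp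
    show "- c \<in> {c. c \<in> eigenvalues T \<and> c > 0}" if "c \<in> {c. c \<in> eigenvalues (\<lambda>v. - T v) \<and> c < 0}" for c
      using that by (auto simp: eigenvalues_def swap)
    show "- c \<in> {c. c \<in> eigenvalues (\<lambda>v. - T v) \<and> c < 0}" if "c \<in> {c. c \<in> eigenvalues T \<and> c > 0}" for c
      using that by (auto simp: eigenvalues_def swap)
    show "dim (eigenspace T (- c)) = dim (eigenspace (\<lambda>v. - T v) c)" for c
      by (simp only: eigenspace_def swap)
  qed auto
  finally show ?thesis .
qed

subsection \<open>Second derivatives\<close>

text \<open>Applied to \<open>(u, v)\<close> and to \<open>(v, u)\<close>, this computes the same second difference in two ways.\<close>

lemma second_difference_eq:
  fixes g :: "'a::real_normed_vector \<Rightarrow> real"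
  assumes g': "\<And>x. (g has_derivative g' x) (at x)"
    and h: "\<And>x. ((\<lambda>x. g' x u) has_derivative h x) (at x)"
    and t: "t > 0"
  obtains p where "dist p x \<le> t * (norm u + norm v)"
    "g (x + t *\<^sub>R u + t *\<^sub>R v) - g (x + t *\<^sub>R u) - g (x + t *\<^sub>R v) + g x = t\<^sup>2 * h p v"
proof -
  \<comment> \<open>The second difference is the increment of \<open>F\<close> from \<open>0\<close>
    to \<open>t\<close>; the mean value theorem is applied along \<open>u\<close>, then along
    \<open>v\<close>.\<close>
  define F where "F s = g (x + t *\<^sub>R v + s *\<^sub>R u) - g (x + s *\<^sub>R u)" for s :: real
  have line: "((\<lambda>s. k (y + s *\<^sub>R w)) has_real_derivative k' (y + s *\<^sub>R w) w) (at s)"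
    if "\<And>x. (k has_derivative k' x) (at x)" for k :: "'a \<Rightarrow> real" and k' y w s
  proof -
    have "((\<lambda>s. k (y + s *\<^sub>R w)) has_derivative (\<lambda>r. k' (y + s *\<^sub>R w) (r *\<^sub>R w))) (at s)"
      by (rule has_derivative_compose[OF _ that]) (auto intro!: derivative_eq_intros)
    moreover have "k' (y + s *\<^sub>R w) (r *\<^sub>R w) = k' (y + s *\<^sub>R w) w * r" for r
      using linear_scale[OF has_derivative_linear[OF that]] by simp
    ultimately show ?thesis by (simp add: has_field_derivative_def)
  qed
  have F': "(F has_real_derivative (g' (x + t *\<^sub>R v + s *\<^sub>R u) u - g' (x + s *\<^sub>R u) u)) (at s)" for s
    unfolding F_def by (intro DERIV_diff line g')
  obtain s where s: "0 < s" "s < t"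
    and Fs: "F t - F 0 = (t - 0) * (g' (x + t *\<^sub>R v + s *\<^sub>R u) u - g' (x + s *\<^sub>R u) u)"
    using MVT2[OF t F'] by blast
  obtain r where r: "0 < r" "r < t"
    and Gr: "g' ((x + s *\<^sub>R u) + t *\<^sub>R v) u - g' ((x + s *\<^sub>R u) + 0 *\<^sub>R v) u
      = (t - 0) * h ((x + s *\<^sub>R u) + r *\<^sub>R v) v"
    using MVT2[OF t line[OF h, of "x + s *\<^sub>R u" v]] by blast
  define p where "p = x + s *\<^sub>R u + r *\<^sub>R v"
  have "dist p x = norm (s *\<^sub>R u + r *\<^sub>R v)" by (simp add: p_def dist_norm)
  also have "\<dots> \<le> s * norm u + r * norm v" using s r by (intro norm_triangle_le) simp
  also have "\<dots> \<le> t * norm u + t * norm v" using s r by (intro add_mono mult_right_mono) auto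
  finally have "dist p x \<le> t * (norm u + norm v)" by (simp add: algebra_simps)
  moreover have "g (x + t *\<^sub>R u + t *\<^sub>R v) - g (x + t *\<^sub>R u) - g (x + t *\<^sub>R v) + g x = t\<^sup>2 * h p v"
    using Fs Gr by (simp add: F_def p_def power2_eq_square algebra_simps)
  ultimately show ?thesis using that by blast
qed

text \<open>Schwarz's theorem: both evaluations of the second difference are
  \<open>t\<^sup>2\<close> times a value of \<open>h\<close> near \<open>x\<close>, and continuity
  of \<open>h\<close> carries their equality over to \<open>x\<close>.\<close>

lemma second_derivative_symmetric:
  fixes g :: "'a::real_normed_vector \<Rightarrow> real"
  assumes g': "\<And>x. (g has_derivative g' x) (at x)"
    and h: "\<And>v x. ((\<lambda>x. g' x v) has_derivative (\<lambda>w. h x w v)) (at x)"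
    and cont: "\<And>v w. continuous_on UNIV (\<lambda>x. h x w v)"
  shows "h x u v = h x v u"
proof -
  have near: "\<forall>\<^sub>F p in nhds x. dist (h p a b) (h x a b) < e" if "e > 0" for a b e
  proof -
    have "isCont (\<lambda>p. h p a b) x"
      using cont[of a b] by (simp add: continuous_on_eq_continuous_at)
    then have "((\<lambda>p. h p a b) \<longlongrightarrow> h x a b) (nhds x)"
      unfolding isCont_def by (rule tendsto_at_iff_tendsto_nhds[THEN iffD1])
    then show ?thesis using that by (rule tendstoD)
  qed
  have "dist (h x u v) (h x v u) \<le> 0"
  proof (rule field_le_epsilon)
    fix e :: real assume e: "e > 0"
    have "\<forall>\<^sub>F p in nhds x. dist (h p u v) (h x u v) < e/2 \<and> dist (h p v u) (h x v u) < e/2"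
      using e by (intro eventually_conj near) auto
    then obtain d where d: "d > 0"
      "\<And>p. dist p x < d \<Longrightarrow> dist (h p u v) (h x u v) < e/2 \<and> dist (h p v u) (h x v u) < e/2"
      unfolding eventually_nhds_metric by blast
    define n where "n = norm u + norm v"
    have n: "n \<ge> 0" by (simp add: n_def)
    \<comment> \<open>The \<open>+ 1\<close> allows \<open>u = v = 0\<close>; both intermediate
      points end up within \<open>d\<close> of \<open>x\<close>.\<close>
    define t where "t = d / (n + 1)"
    have t: "t > 0" using d n by (simp add: t_def)
    have tn: "t * n < d" using d n by (simp add: t_def field_simps)
    obtain p where p: "dist p x \<le> t * (norm u + norm v)"
      "g (x + t *\<^sub>R u + t *\<^sub>R v) - g (x + t *\<^sub>R u) - g (x + t *\<^sub>R v) + g x = t\<^sup>2 * h p v u"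
      using second_difference_eq[OF g' h t] by blast
    obtain q where q: "dist q x \<le> t * (norm v + norm u)"
      "g (x + t *\<^sub>R v + t *\<^sub>R u) - g (x + t *\<^sub>R v) - g (x + t *\<^sub>R u) + g x = t\<^sup>2 * h q u v"
      using second_difference_eq[OF g' h t] by blast
    have "t\<^sup>2 * h p v u = t\<^sup>2 * h q u v" using p(2) q(2) by (simp add: algebra_simps)
    then have "h p v u = h q u v" using t by simp
    moreover have "dist (h p v u) (h x v u) < e/2" "dist (h q u v) (h x u v) < e/2"
      using d(2) p(1) q(1) tn by (auto simp: n_def add.commute)
    ultimately show "dist (h x u v) (h x v u) \<le> 0 + e"
      unfolding dist_real_def by argo
  qed
  then show ?thesis by simp
qed

text \<open>In \<open>h x w v\<close>, \<open>w\<close> is the direction in which \<open>x \<mapsto> g' x v\<close> is differentiated.\<close>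

definition C2_derivs ::
    "('a::real_normed_vector \<Rightarrow> real) \<Rightarrow> ('a \<Rightarrow> 'a \<Rightarrow> real) \<Rightarrow> ('a \<Rightarrow> 'a \<Rightarrow> 'a \<Rightarrow> real) \<Rightarrow> bool" where
  "C2_derivs g g' h \<longleftrightarrow>
    (\<forall>x. (g has_derivative g' x) (at x)) \<and>
    (\<forall>v x. ((\<lambda>x. g' x v) has_derivative (\<lambda>w. h x w v)) (at x)) \<and>
    (\<forall>v w. continuous_on UNIV (\<lambda>x. h x w v))"

section \<open>Calculus of twice continuously differentiable functions\<close>

lemma C2_derivs_smooth:
  assumes "smooth g"
  obtains g' h where "C2_derivs g g' h"
proof -
  have "C_diff (Suc (Suc 0)) g" using assms unfolding smooth_def by blast
  then obtain g' where g': "\<And>x. (g has_derivative g' x) (at x)"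
    and "\<forall>v. \<exists>k. (\<forall>x. ((\<lambda>x. g' x v) has_derivative k x) (at x)) \<and> (\<forall>w. continuous_on UNIV (\<lambda>x. k x w))"
    by auto
  then obtain k where "\<And>v x. ((\<lambda>x. g' x v) has_derivative k v x) (at x)"
    "\<And>v w. continuous_on UNIV (\<lambda>x. k v x w)"
    by metis
  with g' have "C2_derivs g g' (\<lambda>x w v. k v x w)" by (simp add: C2_derivs_def)
  then show ?thesis by (rule that)
qed

lemma C2_derivs_symmetric: "C2_derivs g g' h \<Longrightarrow> h x u v = h x v u"
  using second_derivative_symmetric[of g g' h] unfolding C2_derivs_def by blast

text \<open>An affine substitution has no second derivative, so the chain rule leaves a single term.
  This serves both the slices of \<open>f j\<close> in one variable and its pullback to all
  coordinates.\<close>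

lemma C2_derivs_affine:
  assumes g: "C2_derivs g g' h" and L: "bounded_linear L"
  shows "C2_derivs (\<lambda>x. g (L x + c)) (\<lambda>x v. g' (L x + c) (L v)) (\<lambda>x w v. h (L x + c) (L w) (L v))"
proof -
  have Lc: "((\<lambda>x. L x + c) has_derivative L) (at x)" for x
    using bounded_linear_imp_has_derivative[OF L] by (auto intro!: derivative_eq_intros)
  have cont: "continuous_on UNIV (\<lambda>x. L x + c)"
    by (intro continuous_intros linear_continuous_on L)
  have "continuous_on UNIV (\<lambda>x. h (L x + c) w v)" for w v
    using continuous_on_compose2[OF _ cont, of UNIV "\<lambda>y. h y w v"] g by (simp add: C2_derivs_def)
  moreover have "((\<lambda>x. g (L x + c)) has_derivative (\<lambda>v. g' (L x + c) (L v))) (at x)" for x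
    using has_derivative_compose[OF Lc] g by (auto simp: C2_derivs_def)
  moreover have "((\<lambda>x. g' (L x + c) v) has_derivative (\<lambda>w. h (L x + c) (L w) v)) (at x)" for x v
    using g unfolding C2_derivs_def by (intro has_derivative_compose[OF Lc, of "\<lambda>y. g' y v"]) blast
  ultimately show ?thesis by (simp add: C2_derivs_def)
qed

lemma C2_derivs_inner:
  fixes P Q :: "'a::real_normed_vector \<Rightarrow> 'b::real_inner"
  assumes "bounded_linear P" "bounded_linear Q"
  shows "C2_derivs (\<lambda>x. P x \<bullet> Q x) (\<lambda>x v. P v \<bullet> Q x + P x \<bullet> Q v) (\<lambda>x w v. P v \<bullet> Q w + P w \<bullet> Q v)"
  using bounded_linear_imp_has_derivative[OF assms(1)] bounded_linear_imp_has_derivative[OF assms(2)]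
  unfolding C2_derivs_def by (auto intro!: derivative_eq_intros)

lemma C2_derivs_add:
  assumes "C2_derivs f f' h" "C2_derivs g g' k"
  shows "C2_derivs (\<lambda>x. f x + g x) (\<lambda>x v. f' x v + g' x v) (\<lambda>x w v. h x w v + k x w v)"
  using assms unfolding C2_derivs_def by (auto intro: has_derivative_add continuous_on_add)

lemma C2_derivs_sum:
  assumes "\<And>i. i \<in> I \<Longrightarrow> C2_derivs (g i) (g' i) (h i)"
  shows "C2_derivs (\<lambda>x. \<Sum>i\<in>I. g i x) (\<lambda>x v. \<Sum>i\<in>I. g' i x v) (\<lambda>x w v. \<Sum>i\<in>I. h i x w v)"
  using assms unfolding C2_derivs_def by (auto intro: has_derivative_sum continuous_on_sum)

section \<open>Hessian operators as bilinear forms\<close>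

lemma hessian_has_derivative:
  assumes "C2_derivs g g' h"
  shows "(gradient g has_derivative hessian g x) (at x)"
    and "hessian g x w \<bullet> v = h x w v"
proof -
  have g': "\<And>x. (g has_derivative g' x) (at x)"
    and h: "\<And>v x. ((\<lambda>x. g' x v) has_derivative (\<lambda>w. h x w v)) (at x)"
    using assms by (auto simp: C2_derivs_def)
  have "gradient g = (\<lambda>x. \<Sum>b\<in>Basis. g' x b *\<^sub>R b)"
    using frechet_derivative_at[OF g'] by (simp add: gradient_def fun_eq_iff)
  then have *: "(gradient g has_derivative (\<lambda>w. \<Sum>b\<in>Basis. h x w b *\<^sub>R b)) (at x)"
    by (auto intro!: derivative_eq_intros h)
  then have eq: "hessian g x = (\<lambda>w. \<Sum>b\<in>Basis. h x w b *\<^sub>R b)"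
    unfolding hessian_def by (rule frechet_derivative_at[symmetric])
  show "(gradient g has_derivative hessian g x) (at x)" unfolding eq by (rule *)
  \<comment> \<open>Linearity of \<open>h x w v\<close> in \<open>v\<close> comes from that of
    \<open>g' y\<close>, by differentiating the basis expansion and uniqueness of the
    derivative.\<close>
  have "g' y v = (\<Sum>b\<in>Basis. (v \<bullet> b) * g' y b)" for y
    using linear_sum[OF has_derivative_linear[OF g'[of y]], of "\<lambda>b. (v \<bullet> b) *\<^sub>R b" Basis]
      linear_scale[OF has_derivative_linear[OF g'[of y]]]
    by (simp add: euclidean_representation)
  then have "((\<lambda>y. g' y v) has_derivative (\<lambda>w. \<Sum>b\<in>Basis. (v \<bullet> b) * h x w b)) (at x)"
    by (auto intro!: derivative_eq_intros h)
  from has_derivative_unique[OF this h]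
  have "h x w v = (\<Sum>b\<in>Basis. (v \<bullet> b) * h x w b)" by (rule fun_cong[symmetric])
  also have "\<dots> = hessian g x w \<bullet> v"
    by (simp add: eq inner_sum_left inner_commute[of v] mult.commute)
  finally show "hessian g x w \<bullet> v = h x w v" by simp
qed

lemma hess_xx_inner:
  assumes "C2_derivs g g' h"
  shows "bounded_linear (hess_xx g x y)" "hess_xx g x y w \<bullet> v = h (x, y) (w, 0) (v, 0)"
proof -
  have eq: "hess_xx g x y = hessian (\<lambda>x. g (x, y)) x"
    by (simp add: hess_xx_def hessian_def grad_x_def)
  \<comment> \<open>The slice is written as a linear embedding plus a constant, to fit
    \<open>C2_derivs_affine\<close>.\<close>
  have C2: "C2_derivs (\<lambda>x. g ((x, 0) + (0, y))) (\<lambda>x v. g' ((x, 0) + (0, y)) (v, 0))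
      (\<lambda>x w v. h ((x, 0) + (0, y)) (w, 0) (v, 0))"
    by (intro C2_derivs_affine[OF assms] bounded_linear_Pair bounded_linear_ident bounded_linear_zero)
  show "bounded_linear (hess_xx g x y)" "hess_xx g x y w \<bullet> v = h (x, y) (w, 0) (v, 0)"
    using hessian_has_derivative[OF C2, of x] has_derivative_bounded_linear by (auto simp: eq)
qed

lemma hess_yy_inner:
  assumes "C2_derivs g g' h"
  shows "bounded_linear (hess_yy g x y)" "hess_yy g x y w \<bullet> v = h (x, y) (0, w) (0, v)"
proof -
  have eq: "hess_yy g x y = hessian (\<lambda>y. g (x, y)) y"
    by (simp add: hess_yy_def hessian_def grad_y_def)
  have C2: "C2_derivs (\<lambda>y. g ((0, y) + (x, 0))) (\<lambda>y v. g' ((0, y) + (x, 0)) (0, v))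
      (\<lambda>y w v. h ((0, y) + (x, 0)) (0, w) (0, v))"
    by (intro C2_derivs_affine[OF assms] bounded_linear_Pair bounded_linear_ident bounded_linear_zero)
  show "bounded_linear (hess_yy g x y)" "hess_yy g x y w \<bullet> v = h (x, y) (0, w) (0, v)"
    using hessian_has_derivative[OF C2, of y] has_derivative_bounded_linear by (auto simp: eq)
qed

lemma abs_inner_le_onorm:
  assumes "bounded_linear T" "onorm T \<le> e"
  shows "\<bar>T u \<bullet> u\<bar> \<le> e * (u \<bullet> u)"
proof -
  have "\<bar>T u \<bullet> u\<bar> \<le> norm (T u) * norm u" by (rule Cauchy_Schwarz_ineq2)
  also have "\<dots> \<le> (e * norm u) * norm u"
    using onorm[OF assms(1), of u] mult_right_mono[OF assms(2), of "norm u"]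
    by (intro mult_right_mono) auto
  finally show ?thesis by (simp add: dot_square_norm power2_eq_square)
qed

subsection \<open>The Hessian of the generating family\<close>

lemma zmod_eq_iff: "(zmod m :: 'k::finite mod_ring) = zmod n \<longleftrightarrow> m mod CARD('k) = n mod CARD('k)"
proof -
  have "(zmod m :: 'k mod_ring) = zmod n \<longleftrightarrow> int m mod int CARD('k) = int n mod int CARD('k)"
    unfolding zmod_def by transfer simp
  also have "\<dots> \<longleftrightarrow> m mod CARD('k) = n mod CARD('k)"
    by (simp flip: zmod_int)
  finally show ?thesis .
qed

lemma next_index_zmod: "next_index (zmod n) = zmod (Suc n)"
  unfolding next_index_def zmod_def by transfer (simp add: mod_simps add.commute)

lemma bij_next_index: "bij next_index"
  by (rule bij_betw_byWitness[of _ "\<lambda>j. j - zmod 1"]) (auto simp: next_index_def)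

text \<open>The even residues below \<open>2 * (CARD('k) div 2)\<close> serve. For odd k this leaves
  out k - 1, whose successor is 0.\<close>

lemma exists_nonadjacent_indices:
  obtains E :: "'k::finite mod_ring set"
  where "card E = CARD('k) div 2" "\<And>j. j \<in> E \<Longrightarrow> next_index j \<notin> E"
proof
  define E :: "'k mod_ring set" where "E = (\<lambda>i. zmod (2 * i)) ` {..<CARD('k) div 2}"
  \<comment> \<open>Both \<open>2 * i\<close> and its successor stay below \<open>CARD('k)\<close>,
    so nothing wraps around and parity decides.\<close>
  have lt: "Suc (2 * i) < CARD('k)" if "i < CARD('k) div 2" for i using that by linarith
  have "inj_on (\<lambda>i. zmod (2 * i) :: 'k mod_ring) {..<CARD('k) div 2}"
    using lt by (intro inj_onI) (auto simp: zmod_eq_iff dest!: Suc_lessD)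
  then show "card E = CARD('k) div 2" by (simp add: E_def card_image)
  show "next_index j \<notin> E" if j: "j \<in> E" for j
  proof
    assume "next_index j \<in> E"
    with j obtain i l where "i < CARD('k) div 2" "l < CARD('k) div 2"
      "(zmod (Suc (2 * i)) :: 'k mod_ring) = zmod (2 * l)"
      by (auto simp: E_def next_index_zmod)
    then have "Suc (2 * i) = 2 * l"
      using lt[of i] Suc_lessD[OF lt[of l]] by (simp add: zmod_eq_iff)
    then show False by presburger
  qed
qed

section \<open>Test subspaces supported on a set of indices\<close>

definition test_space :: "real \<Rightarrow> 'k set \<Rightarrow> ('d::finite phase ^ 'k::finite) set" where
  "test_space s E = {w. \<forall>j. snd (w $ j) = s *\<^sub>R fst (w $ j) \<and> (j \<notin> E \<longrightarrow> fst (w $ j) = 0)}"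

lemma subspace_test_space: "subspace (test_space s E)"
  unfolding subspace_def test_space_def by (auto simp: scaleR_add_right)

text \<open>The vectors \<open>(b, s *\<^sub>R b)\<close> in slot \<open>j\<close>, for
  \<open>b\<close> in the basis and \<open>j\<close> in \<open>E\<close>, are nonzero and pairwise
  orthogonal: distinct slots have disjoint supports, and distinct basis vectors are
  orthogonal.\<close>

lemma dim_test_space_ge: "CARD('d) * card E \<le> dim (test_space s E :: ('d::finite phase ^ 'k::finite) set)"
proof -
  define e where "e = (\<lambda>(j, b). axis j (b, s *\<^sub>R b) :: 'd phase ^ 'k)"
  define I where "I = E \<times> (Basis :: (real ^ 'd) set)"
  have orth: "e p \<bullet> e q = 0" if "p \<in> I" "q \<in> I" "p \<noteq> q" for p q
  proof -
    obtain i b j c where "p = (i, b)" "q = (j, c)" by (meson surj_pair)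
    then show ?thesis
      using that inner_not_same_Basis[of b c] by (auto simp: e_def I_def inner_axis_axis)
  qed
  have nz: "e p \<noteq> 0" if "p \<in> I" for p
    using that by (auto simp: e_def I_def axis_eq_0_iff zero_prod_def)
  have "pairwise orthogonal (e ` I)"
    unfolding pairwise_def orthogonal_def using orth by blast
  then have "independent (e ` I)"
    using nz by (intro pairwise_orthogonal_independent) auto
  moreover have "e ` I \<subseteq> test_space s E"
    by (auto simp: e_def I_def test_space_def axis_def)
  ultimately have "card (e ` I) \<le> dim (test_space s E :: ('d phase ^ 'k) set)"
    by (intro independent_card_le_dim)
  moreover have "inj_on e I"
  proof (rule inj_onI, rule ccontr)
    fix p q assume "p \<in> I" "q \<in> I" "e p = e q" "p \<noteq> q"
    then show False using orth[of p q] nz[of q] by simp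
  qed
  then have "card (e ` I) = card E * CARD('d)"
    by (simp add: card_image I_def card_cartesian_product)
  ultimately show ?thesis by (simp add: mult.commute)
qed

text \<open>The argument of \<open>f j\<close> in the generating family. It is linear in
  \<open>w\<close>, so \<open>f j\<close> enters as a linear pullback.\<close>

definition adjacent_coords :: "'d::finite phase ^ 'k::finite mod_ring \<Rightarrow> 'k mod_ring \<Rightarrow> 'd phase" where
  "adjacent_coords w j = (fst (w $ next_index j), snd (w $ j))"

lemma bounded_linear_coords:
  "bounded_linear (\<lambda>w. fst (w $ j))" "bounded_linear (\<lambda>w. snd (w $ j))"
  by (intro bounded_linear_fst_comp bounded_linear_snd_comp bounded_linear_vec_nth)+

text \<open>Each summand is a bilinear coupling plus a linear pullback of \<open>f j\<close>. The
  first derivative stays existential, since the index depends on the second one alone.\<close>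

lemma C2_derivs_generating_family:
  fixes f :: "'k::finite mod_ring \<Rightarrow> 'd::finite phase \<Rightarrow> real"
  assumes "\<And>j. C2_derivs (f j) (f' j) (h j)"
  obtains F' where "C2_derivs (generating_family f) F'
    (\<lambda>z w v. \<Sum>j\<in>UNIV. snd (v $ j) \<bullet> (fst (w $ next_index j) - fst (w $ j))
       + snd (w $ j) \<bullet> (fst (v $ next_index j) - fst (v $ j))
       + h j (adjacent_coords z j) (adjacent_coords w j) (adjacent_coords v j))"
proof -
  have L: "bounded_linear (\<lambda>w :: 'd phase ^ 'k mod_ring. adjacent_coords w j)" for j
    unfolding adjacent_coords_def by (intro bounded_linear_Pair bounded_linear_coords)
  have "C2_derivs (\<lambda>z. snd (z $ j) \<bullet> (fst (z $ next_index j) - fst (z $ j)) + f j (adjacent_coords z j + 0))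
    (\<lambda>z v. snd (v $ j) \<bullet> (fst (z $ next_index j) - fst (z $ j))
       + snd (z $ j) \<bullet> (fst (v $ next_index j) - fst (v $ j))
       + f' j (adjacent_coords z j + 0) (adjacent_coords v j))
    (\<lambda>z w v. snd (v $ j) \<bullet> (fst (w $ next_index j) - fst (w $ j))
       + snd (w $ j) \<bullet> (fst (v $ next_index j) - fst (v $ j))
       + h j (adjacent_coords z j + 0) (adjacent_coords w j) (adjacent_coords v j))" for j
    by (rule C2_derivs_add[OF C2_derivs_inner[OF bounded_linear_coords(2)
            bounded_linear_sub[OF bounded_linear_coords(1) bounded_linear_coords(1)]]
          C2_derivs_affine[OF assms L]])
  from C2_derivs_sum[of UNIV, OF this] show ?thesis
    by (intro that) (simp add: generating_family_def[abs_def] adjacent_coords_def)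
qed

text \<open>The factor \<open>s\<close> treats both signs at once: after multiplication by
  \<open>s\<close> the couplings contribute \<open>- 2 * q j\<close>, because
  \<open>s * s = 1\<close>. Here \<open>h j\<close> stands for the second derivative of
  \<open>f j\<close> at a fixed point.\<close>

lemma hessian_form_neg_on_test_space:
  fixes h :: "'k::finite mod_ring \<Rightarrow> 'd::finite phase \<Rightarrow> 'd phase \<Rightarrow> real"
  assumes xx: "\<And>j u. \<bar>h j (u, 0) (u, 0)\<bar> \<le> \<epsilon> * (u \<bullet> u)"
    and yy: "\<And>j u. \<bar>h j (0, u) (0, u)\<bar> \<le> \<epsilon> * (u \<bullet> u)"
    and eps: "\<epsilon> < 1" and s: "\<bar>s\<bar> = 1"
    and E: "\<And>j. j \<in> E \<Longrightarrow> next_index j \<notin> E"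
    and w: "w \<in> test_space s E" "w \<noteq> 0"
  shows "s * (\<Sum>j\<in>UNIV. snd (w $ j) \<bullet> (fst (w $ next_index j) - fst (w $ j))
       + snd (w $ j) \<bullet> (fst (w $ next_index j) - fst (w $ j))
       + h j (adjacent_coords w j) (adjacent_coords w j)) < 0"
proof -
  define a where "a j = fst (w $ j)" for j
  define q where "q j = a j \<bullet> a j" for j
  have w_eq: "w $ j = (a j, s *\<^sub>R a j)" and aE: "j \<notin> E \<Longrightarrow> a j = 0" for j
    using w(1) by (auto simp: test_space_def a_def prod_eq_iff)
  have ss: "s * s = 1" using s by (metis abs_mult_self_eq mult_1)
  have term_le: "s * (snd (w $ j) \<bullet> (fst (w $ next_index j) - fst (w $ j))
       + snd (w $ j) \<bullet> (fst (w $ next_index j) - fst (w $ j))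
       + h j (adjacent_coords w j) (adjacent_coords w j))
     \<le> \<epsilon> * q (next_index j) - (2 - \<epsilon>) * q j" (is "?t \<le> _") for j
  proof -
    \<comment> \<open>At most one of two neighbouring slots is occupied, so
      \<open>adjacent_coords w j\<close> has the form \<open>(u, 0)\<close> or
      \<open>(0, u)\<close>, and \<open>xx\<close> or \<open>yy\<close> bounds the term.\<close>
    have disj: "a j = 0 \<or> a (next_index j) = 0" using aE E by blast
    have "\<bar>h j (adjacent_coords w j) (adjacent_coords w j)\<bar> \<le> \<epsilon> * (q (next_index j) + q j)"
      using disj xx[of j "a (next_index j)"] yy[of j "s *\<^sub>R a j"] ss
      by (auto simp: adjacent_coords_def w_eq q_def simp flip: mult.assoc)
    then have "s * h j (adjacent_coords w j) (adjacent_coords w j) \<le> \<epsilon> * (q (next_index j) + q j)"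
      using s abs_ge_self[of "s * h j (adjacent_coords w j) (adjacent_coords w j)"]
      by (simp add: abs_mult)
    moreover have "s * (snd (w $ j) \<bullet> (fst (w $ next_index j) - fst (w $ j))) = - q j"
      using disj ss by (auto simp: w_eq q_def inner_diff_right simp flip: mult.assoc)
    ultimately show ?thesis by (simp add: algebra_simps)
  qed
  \<comment> \<open>The shift permutes the indices, so the bounds add up to
    \<open>- (2 * (1 - \<epsilon>))\<close> times the sum of the \<open>q j\<close>.\<close>
  have "(\<Sum>j\<in>UNIV. q (next_index j)) = (\<Sum>j\<in>UNIV. q j)"
    using sum.reindex_bij_betw[OF bij_next_index] .
  then have "(\<Sum>j\<in>UNIV. \<epsilon> * q (next_index j) - (2 - \<epsilon>) * q j) = - (2 * (1 - \<epsilon>)) * (\<Sum>j\<in>UNIV. q j)"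
    by (simp add: sum_subtractf flip: sum_distrib_left) (simp add: algebra_simps)
  moreover have "(\<Sum>j\<in>UNIV. q j) > 0"
  proof -
    obtain i where "w $ i \<noteq> 0" using w(2) by (auto simp: vec_eq_iff)
    then have "q i > 0" by (auto simp: w_eq q_def zero_prod_def)
    then show ?thesis by (intro sum_pos2[of UNIV i]) (auto simp: q_def)
  qed
  ultimately have "(\<Sum>j\<in>UNIV. \<epsilon> * q (next_index j) - (2 - \<epsilon>) * q j) < 0"
    using eps by (simp add: mult_neg_pos)
  moreover have "s * (\<Sum>j\<in>UNIV. snd (w $ j) \<bullet> (fst (w $ next_index j) - fst (w $ j))
       + snd (w $ j) \<bullet> (fst (w $ next_index j) - fst (w $ j))
       + h j (adjacent_coords w j) (adjacent_coords w j))
     \<le> (\<Sum>j\<in>UNIV. \<epsilon> * q (next_index j) - (2 - \<epsilon>) * q j)"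
    unfolding sum_distrib_left by (intro sum_mono term_le)
  ultimately show ?thesis by linarith
qed

section \<open>Lower bounds for index and coindex\<close>

theorem proposition1p2:
  fixes \<phi> :: "'d::finite phase \<Rightarrow> 'd phase"
    and \<phi>s :: "'k::finite mod_ring \<Rightarrow> 'd phase \<Rightarrow> 'd phase"
    and f :: "'k mod_ring \<Rightarrow> 'd phase \<Rightarrow> real"
    and z :: "'d phase ^ ('k mod_ring)"
    and \<epsilon> :: real
  assumes "hamiltonian_diffeo \<phi>"
    and "\<phi> = cyclic_comp \<phi>s"
    and "\<And>j. hamiltonian_diffeo (\<phi>s j)"
    and "\<And>j. generating_function (f j) (\<phi>s j)"
    and "critical_point (generating_family f) z"
    and "\<epsilon> < 1"
    and "\<And>j. onorm (hess_xx (f j) (fst (z $ next_index j)) (snd (z $ j))) \<le> \<epsilon>"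
    and "\<And>j. onorm (hess_xy (f j) (fst (z $ next_index j)) (snd (z $ j))) \<le> \<epsilon>"
    and "\<And>j. onorm (hess_yy (f j) (fst (z $ next_index j)) (snd (z $ j))) \<le> \<epsilon>"
  shows "min (morse_index (generating_family f) z) (morse_coindex (generating_family f) z)
           \<ge> CARD('d) * (CARD('k) div 2)"
proof -
  have "\<exists>f' h. C2_derivs (f j) f' h" for j
    using assms(4) C2_derivs_smooth unfolding generating_function_def by metis
  then obtain f' h where fh: "\<And>j. C2_derivs (f j) (f' j) (h j)" by metis
  obtain F' where F: "C2_derivs (generating_family f) F'
    (\<lambda>z w v. \<Sum>j\<in>UNIV. snd (v $ j) \<bullet> (fst (w $ next_index j) - fst (w $ j))
       + snd (w $ j) \<bullet> (fst (v $ next_index j) - fst (v $ j))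
       + h j (adjacent_coords z j) (adjacent_coords w j) (adjacent_coords v j))"
    by (rule C2_derivs_generating_family[OF fh])
  define T where "T = hessian (generating_family f) z"
  note T = hessian_has_derivative[OF F, of z, folded T_def]
  have lin: "linear T" using T(1) by (rule has_derivative_linear)
  have sym: "T u \<bullet> v = u \<bullet> T v" for u v
    using C2_derivs_symmetric[OF F, where x=z and u=u and v=v] T(2)[of u v] T(2)[of v u]
    by (simp only: inner_commute[of u])
  have xx: "\<bar>h j (adjacent_coords z j) (u, 0) (u, 0)\<bar> \<le> \<epsilon> * (u \<bullet> u)" for j u
    using abs_inner_le_onorm[OF hess_xx_inner(1)[OF fh] assms(7)[of j]] hess_xx_inner(2)[OF fh]
    by (simp add: adjacent_coords_def)
  have yy: "\<bar>h j (adjacent_coords z j) (0, u) (0, u)\<bar> \<le> \<epsilon> * (u \<bullet> u)" for j u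
    using abs_inner_le_onorm[OF hess_yy_inner(1)[OF fh] assms(9)[of j]] hess_yy_inner(2)[OF fh]
    by (simp add: adjacent_coords_def)
  obtain E :: "'k mod_ring set" where E: "card E = CARD('k) div 2" "\<And>j. j \<in> E \<Longrightarrow> next_index j \<notin> E"
    using exists_nonadjacent_indices[where 'k='k] by blast
  have definite: "s * (T w \<bullet> w) < 0" if "\<bar>s\<bar> = 1" "w \<in> test_space s E" "w \<noteq> 0" for s w
    unfolding T(2)
    using xx yy assms(6) that(1) E(2) that(2,3)
    by (rule hessian_form_neg_on_test_space[where h = "\<lambda>j. h j (adjacent_coords z j)"])
  \<comment> \<open>Slope \<open>s = 1\<close> makes the Hessian negative definite on the test
    space; slope \<open>s = -1\<close>, used for the coindex, makes it positive definite.\<close>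
  have "CARD('d) * card E \<le> morse_index (generating_family f) z"
    unfolding morse_index_def T_def[symmetric]
    using dim_test_space_ge[of E 1, where 'd='d] definite[of 1]
    by (intro order_trans[OF _ dim_negative_subspace_le[OF lin sym subspace_test_space[of 1 E]]]) auto
  moreover have "CARD('d) * card E \<le> morse_coindex (generating_family f) z"
    unfolding morse_coindex_def T_def[symmetric]
    using dim_test_space_ge[of E "-1", where 'd='d] definite[of "-1"]
    by (intro order_trans[OF _ dim_positive_subspace_le[OF lin sym subspace_test_space[of "-1" E]]]) auto
  ultimately show ?thesis by (simp add: E(1))
qed

end
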